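(* Assume that $K$ is a bounded linear operator from $\mathcal{H}$ to $\mathcal{H}'$ with $\|K\|<1$, that $1\le p\le 2$, and that the entries in the sequence $\mathbf{w}=(w_\gamma)_{\gamma\in\Gamma}$ are bounded below uniformly by a strictly positive number $c$. Assume that either $p>1$ or $\mathrm{N}(K)=\{0\}$. For any $g\in\mathcal{H}'$ and any $\mu>0$, define $f^\star_{\mu,\mathbf{w},p;g}$ to be the minimizer over $f\in\mathcal{H}$ of $$\Phi_{\mu,\mathbf{w},p;g}(f)=\|Kf-g\|^2+\mu\,|||f|||_{\mathbf{w},p}^p .$$ If $\mu=\mu(\epsilon)$ satisfies the requirements $$\lim_{\epsilon\to0}\mu(\epsilon)=0\quad\text{and}\quad\lim_{\epsilon\to0}\epsilon^2/\mu(\epsilon)=0,$$ then we have, for any $f_o\in\mathcal{H}$, $$\lim_{\epsilon\to0}\Big[\sup_{\|g-Kf_o\|\le\epsilon}\|f^\star_{\mu(\epsilon),\mathbf{w},p;g}-f^\dagger\|\Big]=0,$$ where $f^\dagger$ is the unique element of minimum $|||\cdot|||_{\mathbf{w},p}$-norm in $\mathcal{S}=\mathrm{N}(K)+f_o=\{f\in\mathcal{H}:Kf=Kf_o\}$.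
   Context: $\mathcal{H}$ and $\mathcal{H}'$ are real Hilbert spaces, $(\varphi_\gamma)_{\gamma\in\Gamma}$ is an orthonormal basis of $\mathcal{H}$, $\mathrm{N}(K)=\{f\in\mathcal{H}:Kf=0\}$ is the null space of $K$, and $$|||f|||_{\mathbf{w},p}=\Big[\sum_{\gamma\in\Gamma}w_\gamma|\langle f,\varphi_\gamma\rangle|^p\Big]^{1/p}.$$ The function $\mu(\epsilon)>0$ is defined for noise levels $\epsilon>0$, and the supremum is over $g\in\mathcal{H}'$. Under the stated hypotheses the minimizer $f^\star_{\mu,\mathbf{w},p;g}$ is unique. If $\mathrm{N}(K)=\{0\}$, then $f^\dagger=f_o$.
   Formalization: It is additionally assumed that S = N(K)+f_o contains an element of finite |||·|||_{w,p}-norm; otherwise f† is undefined when N(K)≠{0}, and when N(K)={0} the convergence claim can fail for f_o of infinite |||·|||-norm. *)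

theory Defs
  imports "HOL-Analysis.Analysis"
begin

definition orthonormal_basis_on :: "'i set \<Rightarrow> ('i \<Rightarrow> 'a::real_inner) \<Rightarrow> bool" where
  "orthonormal_basis_on \<Gamma> \<phi> \<longleftrightarrow>
     (\<forall>i\<in>\<Gamma>. \<forall>j\<in>\<Gamma>. \<phi> i \<bullet> \<phi> j = (if i = j then 1 else 0)) \<and>
     closure (span (\<phi> ` \<Gamma>)) = UNIV"

definition null_space :: "('a::real_vector \<Rightarrow> 'b::real_vector) \<Rightarrow> 'a set" where
  "null_space K = {f. K f = 0}"

text \<open>Real powers on \<open>[0,\<infinity>]\<close>, meant for exponents \<open>p > 0\<close>.\<close>

definition ennpowr :: "ennreal \<Rightarrow> real \<Rightarrow> ennreal" where
  "ennpowr x p = (if x = \<infinity> then \<infinity> else ennreal (enn2real x powr p))"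

text \<open>
  The weighted \<open>p\<close>-norm is not finite on all of the Hilbert space, hence it takes values in
  \<open>[0,\<infinity>]\<close>; there the sum over an index set of arbitrary cardinality always exists, being
  the supremum of the finite partial sums.
\<close>

definition wp_norm :: "'i set \<Rightarrow> ('i \<Rightarrow> 'a::real_inner) \<Rightarrow> ('i \<Rightarrow> real) \<Rightarrow> real \<Rightarrow> 'a \<Rightarrow> ennreal" where
  "wp_norm \<Gamma> \<phi> w p f =
     ennpowr (\<Sum>\<^sub>\<infinity>\<gamma>\<in>\<Gamma>. ennreal (w \<gamma> * \<bar>f \<bullet> \<phi> \<gamma>\<bar> powr p)) (1 / p)"

lemma ennpowr_wp_norm:
  assumes "p > 0"
  shows "ennpowr (wp_norm \<Gamma> \<phi> w p f) p = (\<Sum>\<^sub>\<infinity>\<gamma>\<in>\<Gamma>. ennreal (w \<gamma> * \<bar>f \<bullet> \<phi> \<gamma>\<bar> powr p))"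
  using assms by (auto simp: ennpowr_def wp_norm_def powr_powr less_top)

definition \<Phi> :: "('a::real_inner \<Rightarrow> 'b::real_inner) \<Rightarrow> 'i set \<Rightarrow> ('i \<Rightarrow> 'a) \<Rightarrow> ('i \<Rightarrow> real) \<Rightarrow> real \<Rightarrow>
    real \<Rightarrow> 'b \<Rightarrow> 'a \<Rightarrow> ennreal" where
  "\<Phi> K \<Gamma> \<phi> w p \<mu> g f =
     ennreal ((norm (K f - g))\<^sup>2) + ennreal \<mu> * ennpowr (wp_norm \<Gamma> \<phi> w p f) p"

definition f_star :: "('a::real_inner \<Rightarrow> 'b::real_inner) \<Rightarrow> 'i set \<Rightarrow> ('i \<Rightarrow> 'a) \<Rightarrow> ('i \<Rightarrow> real) \<Rightarrow> real \<Rightarrow>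
    real \<Rightarrow> 'b \<Rightarrow> 'a" where
  "f_star K \<Gamma> \<phi> w p \<mu> g = arg_min_on (\<Phi> K \<Gamma> \<phi> w p \<mu> g) UNIV"

definition solution_set :: "('a::real_inner \<Rightarrow> 'b::real_inner) \<Rightarrow> 'a \<Rightarrow> 'a set" where
  "solution_set K f\<^sub>o = {f. K f = K f\<^sub>o}"

definition f_dagger :: "('a::real_inner \<Rightarrow> 'b::real_inner) \<Rightarrow> 'i set \<Rightarrow> ('i \<Rightarrow> 'a) \<Rightarrow> ('i \<Rightarrow> real) \<Rightarrow> real \<Rightarrow>
    'a \<Rightarrow> 'a" where
  "f_dagger K \<Gamma> \<phi> w p f\<^sub>o = arg_min_on (wp_norm \<Gamma> \<phi> w p) (solution_set K f\<^sub>o)"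

end

theory Submission
  imports Defs
begin

text \<open>
  Write \<open>Q\<close> for the \<open>p\<close>-th power of the weighted norm (\<open>penalty\<close> below). Three facts
  carry the proof.

  Existence needs a weak form of compactness only: in a Hilbert space a decreasing sequence of
  nonempty, closed, bounded, midpoint-convex sets has a common point
  (\<open>nested_midpoint_convex_Inter_nonempty\<close>), because almost-shortest elements of the sets form a
  Cauchy sequence by the parallelogram law. Applied to sublevel sets this yields minimizers of
  \<open>\<Phi>\<close> over closed convex sets on which it is somewhere finite, for index sets of any cardinality and for \<open>p = 1\<close> as well. The
  sublevel sets are closed because \<open>Q\<close> is a supremum of continuous finite partial sums, and
  bounded because \<open>p \<le> 2\<close> and the lower bound on the weights give
  \<open>\<parallel>f\<parallel>\<^sup>p \<le> Q f / c\<close>. Two distinct minimizers would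
  have a midpoint with a strictly smaller value: if their images under \<open>K\<close> differ, the squared
  residual gains; if not, then \<open>K\<close> is not injective, hence \<open>p > 1\<close> and \<open>Q\<close> gains. The element
  \<open>f\<^sup>\<dagger>\<close> is covered by the same argument, since on the solution set \<open>\<Phi>\<close> with unit parameter and
  data \<open>K f\<^sub>o\<close> is just \<open>Q\<close>.

  Comparing the values of \<open>\<Phi>\<close> at its minimizer \<open>f\<^sup>\<star>\<close> and at \<open>f\<^sup>\<dagger>\<close> gives
  \<open>Q f\<^sup>\<star> \<le> Q f\<^sup>\<dagger> + \<epsilon>\<^sup>2 / \<mu>\<close> and \<open>\<parallel>K f\<^sup>\<star> - K f\<^sup>\<dagger>\<parallel> \<le> sqrt (\<epsilon>\<^sup>2 + \<mu> * Q f\<^sup>\<dagger>) + \<epsilon>\<close>.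
  By the two conditions on \<open>\<mu>\<close>, the minimizers nearly solve the problem that defines \<open>f\<^sup>\<dagger>\<close>. If
  they stayed on the far side of a hyperplane from \<open>f\<^sup>\<dagger>\<close>, the nested-set
  principle would produce a second solution of that problem there; so they converge weakly
  (\<open>weak_tendsto_of_near_minimal\<close>).

  Weak convergence together with \<open>limsup Q f\<^sup>\<star> \<le> Q f\<^sup>\<dagger>\<close> forces norm convergence
  (\<open>penalty_radon_riesz\<close>): on finitely many coordinates the values of \<open>Q\<close> converge, so no
  mass is left for the remaining coordinates beyond the small tail of \<open>f\<^sup>\<dagger>\<close>. Uniformity in the
  data comes from choosing, for each noise level, data that violate the desired bound if there
  are any.
\<close>

section \<open>Minimization in Hilbert space\<close>

text \<open>
  The parallelogram law, in the form used both for the Cauchy estimate below and for strict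
  convexity of the squared residual.
\<close>

lemma norm_midpoint_sq:
  fixes x y :: "'a::real_inner"
  shows "(norm (midpoint x y))\<^sup>2 = ((norm x)\<^sup>2 + (norm y)\<^sup>2) / 2 - (norm (x - y))\<^sup>2 / 4"
  unfolding midpoint_def power2_norm_eq_inner
  by (simp add: inner_add_left inner_add_right inner_diff_left inner_diff_right inner_commute
      field_simps)

text \<open>
  This replaces weak compactness of balls. Let \<open>d n\<close> be the infimum of the squared norm on
  \<open>C n\<close> and choose \<open>x n\<close> that almost attains it. The midpoint of two late \<open>x m\<close>, \<open>x n\<close> still lies in an
  early set \<open>C M\<close>, so it is no shorter than \<open>d M\<close> permits; as \<open>d\<close> converges, the parallelogram law
  leaves no room for a distance between \<open>x m\<close> and \<open>x n\<close>.
\<close>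

lemma nested_midpoint_convex_Inter_nonempty:
  fixes C :: "nat \<Rightarrow> 'a::{real_inner, complete_space} set"
  assumes ne: "\<And>n. C n \<noteq> {}" and cl: "\<And>n. closed (C n)" and dec: "decseq C"
    and bd: "bounded (C 0)"
    and mid: "\<And>n x y. x \<in> C n \<Longrightarrow> y \<in> C n \<Longrightarrow> midpoint x y \<in> C n"
  shows "(\<Inter>n. C n) \<noteq> {}"
proof -
  define d where "d n = (INF x\<in>C n. (norm x)\<^sup>2)" for n
  have bdd: "bdd_below ((\<lambda>x. (norm x)\<^sup>2) ` C n)" for n
    by (rule bdd_belowI[of _ 0]) auto
  have d_le: "d n \<le> (norm x)\<^sup>2" if "x \<in> C n" for n x
    unfolding d_def using that bdd by (rule cINF_lower[rotated])
  obtain B where B: "\<And>x. x \<in> C 0 \<Longrightarrow> norm x \<le> B"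
    using bd unfolding bounded_iff by blast
  have sub: "C m \<subseteq> C n" if "n \<le> m" for m n
    using dec that by (simp add: decseq_def)
  have d_mono: "incseq d"
    unfolding incseq_def d_def using bdd ne sub by (intro allI impI cINF_superset_mono) auto
  have d_bd: "d n \<le> B\<^sup>2" for n
  proof -
    obtain x where x: "x \<in> C n" using ne by blast
    then have "norm x \<le> B" using B sub[of 0 n] by auto
    then have "(norm x)\<^sup>2 \<le> B\<^sup>2" by (simp add: power_mono)
    then show ?thesis using d_le[OF x] by linarith
  qed
  obtain L where L: "d \<longlonglongrightarrow> L" and d_L: "\<And>n. d n \<le> L"
    using incseq_convergent[OF d_mono] d_bd by blast
  have "\<exists>x\<in>C n. (norm x)\<^sup>2 < d n + 1 / Suc n" for n
    using cInf_lessD[of "(\<lambda>x. (norm x)\<^sup>2) ` C n" "d n + 1 / Suc n"] ne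
    unfolding d_def by auto
  then obtain x where xC: "\<And>n. x n \<in> C n" and xd: "\<And>n. (norm (x n))\<^sup>2 < d n + 1 / Suc n"
    by metis
  have gap: "(norm (x m - x n))\<^sup>2 \<le> 4 * (L - d M + 1 / Suc M)" if "M \<le> m" "M \<le> n" for m n M
  proof -
    have "midpoint (x m) (x n) \<in> C M"
      using xC sub that by (blast intro: mid)
    then have "d M \<le> (norm (midpoint (x m) (x n)))\<^sup>2" by (rule d_le)
    moreover have le: "(norm (x k))\<^sup>2 \<le> L + 1 / Suc M" if "M \<le> k" for k
    proof -
      have "1 / real (Suc k) \<le> 1 / Suc M" using that by (intro divide_left_mono) auto
      then show ?thesis using xd[of k] d_L[of k] by linarith
    qed
    ultimately show ?thesis
      using norm_midpoint_sq[of "x m" "x n"] le[OF that(1)] le[OF that(2)] by argo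
  qed
  have "(\<lambda>M. 4 * (L - d M + 1 / Suc M)) \<longlonglongrightarrow> 4 * (L - L + 0)"
    by (intro tendsto_intros L LIMSEQ_Suc[OF lim_1_over_n])
  then have lim0: "(\<lambda>M. 4 * (L - d M + 1 / Suc M)) \<longlonglongrightarrow> 0" by simp
  have "Cauchy x"
  proof (rule CauchyI)
    fix e :: real assume e: "0 < e"
    then have "eventually (\<lambda>M. 4 * (L - d M + 1 / Suc M) < e\<^sup>2) sequentially"
      using lim0 by (intro order_tendstoD(2)) auto
    then obtain M where M: "4 * (L - d M + 1 / Suc M) < e\<^sup>2"
      using eventually_happens'[OF sequentially_bot] by fast
    show "\<exists>M. \<forall>m\<ge>M. \<forall>n\<ge>M. norm (x m - x n) < e"
    proof (intro exI allI impI)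
      fix m n assume "M \<le> m" "M \<le> n"
      then have "(norm (x m - x n))\<^sup>2 < e\<^sup>2" using gap M by (meson le_less_trans)
      then show "norm (x m - x n) < e" using e by (meson less_imp_le power2_less_imp_less)
    qed
  qed
  then obtain l where l: "x \<longlonglongrightarrow> l"
    using Cauchy_convergent_iff convergent_def by blast
  have "l \<in> C n" for n
  proof (rule Lim_in_closed_set[OF cl _ _ l])
    show "\<forall>\<^sub>F k in sequentially. x k \<in> C n"
      using xC sub by (auto intro!: eventually_sequentiallyI[of n])
  qed simp
  then show ?thesis by blast
qed

text \<open>
  The nested sets are the sublevel sets just above the infimum; finiteness of \<open>J\<close> at one point
  of \<open>S\<close> makes the infimum a real number.
\<close>

lemma convex_lsc_coercive_attains_min:
  fixes J :: "'a::{real_inner, complete_space} \<Rightarrow> ennreal"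
  assumes S: "closed S" "convex S"
    and cl: "\<And>t. 0 \<le> t \<Longrightarrow> closed {f. J f \<le> ennreal t}"
    and bd: "\<And>t. 0 \<le> t \<Longrightarrow> bounded {f. J f \<le> ennreal t}"
    and mid: "\<And>t f h. 0 \<le> t \<Longrightarrow> J f \<le> ennreal t \<Longrightarrow> J h \<le> ennreal t \<Longrightarrow> J (midpoint f h) \<le> ennreal t"
    and f0: "f0 \<in> S" "J f0 < \<infinity>"
  shows "\<exists>f. is_arg_min J (\<lambda>f. f \<in> S) f"
proof -
  define I where "I = (INF f\<in>S. J f)"
  have "I < \<infinity>" unfolding I_def using INF_lower[OF f0(1), of J] f0(2) by (rule le_less_trans)
  then obtain a where a: "0 \<le> a" "I = ennreal a" by (cases I) auto
  define C where "C n = S \<inter> {f. J f \<le> ennreal (a + 1 / Suc n)}" for n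
  have "(\<Inter>n. C n) \<noteq> {}"
  proof (rule nested_midpoint_convex_Inter_nonempty)
    show "C n \<noteq> {}" for n
    proof -
      have "I < ennreal (a + 1 / Suc n)" using a by (simp add: ennreal_less_iff)
      then show ?thesis unfolding I_def INF_less_iff C_def by (auto intro: less_imp_le)
    qed
    show "closed (C n)" for n unfolding C_def using S a by (intro closed_Int cl) auto
    show "decseq C" unfolding decseq_def C_def
    proof (intro allI impI Int_mono subset_refl subsetI CollectI; elim CollectE)
      fix m n f assume mn: "m \<le> n" and J: "J f \<le> ennreal (a + 1 / Suc n)"
      have "1 / real (Suc n) \<le> 1 / Suc m" using mn by (intro divide_left_mono) auto
      then show "J f \<le> ennreal (a + 1 / Suc m)"
        using J a by (elim order_trans) (simp add: ennreal_le_iff)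
    qed
    show "bounded (C 0)" unfolding C_def using bd[of "a + 1 / Suc 0"] a
      by (intro bounded_Int disjI2) simp
    show "midpoint x y \<in> C n" if "x \<in> C n" "y \<in> C n" for n x y
    proof -
      have "midpoint x y \<in> S"
        using that \<open>convex S\<close> unfolding C_def midpoint_def
        by (auto simp: scaleR_add_right intro: convexD)
      then show ?thesis
        using that a mid[of "a + 1 / Suc n" x y] unfolding C_def by (auto simp del: ennreal_plus)
    qed
  qed
  then obtain f where f: "f \<in> S" "\<And>n. J f \<le> ennreal (a + 1 / Suc n)"
    unfolding C_def by auto
  have "J f \<le> ennreal a"
  proof (rule LIMSEQ_le_const)
    have "(\<lambda>n. a + 1 / Suc n) \<longlonglongrightarrow> a + 0"
      by (intro tendsto_intros LIMSEQ_Suc[OF lim_1_over_n])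
    then show "(\<lambda>n. ennreal (a + 1 / Suc n)) \<longlonglongrightarrow> ennreal a"
      using tendsto_ennrealI by fastforce
    show "\<exists>N. \<forall>n\<ge>N. J f \<le> ennreal (a + 1 / Suc n)" using f by blast
  qed
  moreover have "I \<le> J y" if "y \<in> S" for y
    unfolding I_def using that by (rule INF_lower)
  ultimately have "J f \<le> J y" if "y \<in> S" for y
    using that a by (metis order_trans)
  then show ?thesis using f(1) unfolding is_arg_min_def by (auto simp: not_less)
qed

section \<open>Scalar inequalities\<close>

text \<open>
  For \<open>0 \<le> a < b\<close> the mean slopes of \<open>t powr p\<close> on the two halves of the interval from \<open>a\<close> to
  \<open>b\<close> are derivatives at interior points, and the derivative is strictly increasing. At the end point
  \<open>a\<close>, possibly \<open>0\<close>, the mean value theorem asks for continuity only.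
  The general case follows from the triangle inequality, except that for \<open>y = - x\<close> the absolute values agree
  and the gap comes from the midpoint being \<open>0\<close>.
\<close>

lemma abs_powr_midpoint_strict:
  fixes x y p :: real
  assumes p: "1 < p" and ne: "x \<noteq> y"
  shows "\<bar>(x + y) / 2\<bar> powr p < (\<bar>x\<bar> powr p + \<bar>y\<bar> powr p) / 2"
proof -
  have strict: "((a + b) / 2) powr p < (a powr p + b powr p) / 2" if ab: "0 \<le> a" "a < b" for a b
  proof -
    define m where "m = (a + b) / 2"
    have m: "a < m" "m < b" "m - a = (b - a) / 2" "b - m = (b - a) / 2"
      using ab unfolding m_def by (auto simp: field_simps)
    have der: "((\<lambda>t. t powr p) has_real_derivative p * t powr (p - 1)) (at t)" if "0 < t" for t
      using that by (auto intro!: derivative_eq_intros)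
    have cont: "continuous_on {u..v} (\<lambda>t. t powr p)" if "0 \<le> u" for u v
      using that p by (intro continuous_on_powr') (auto intro!: continuous_intros)
    have slope: "\<exists>z>u. z < v \<and> v powr p - u powr p = (v - u) * (p * z powr (p - 1))"
      if uv: "0 \<le> u" "u < v" for u v
    proof -
      have "(\<lambda>t. t powr p) differentiable (at t)" if "u < t" for t
        using der[of t] that uv real_differentiable_def by auto
      then obtain l z where z: "u < z" "z < v" "DERIV (\<lambda>t. t powr p) z :> l"
        "v powr p - u powr p = (v - u) * l"
        using MVT[OF uv(2) cont[OF uv(1)]] by blast
      then have "l = p * z powr (p - 1)"
        using uv by (intro DERIV_unique[OF z(3) der]) auto
      then show ?thesis using z by blast
    qed
    obtain z1 where z1: "a < z1" "z1 < m" "m powr p - a powr p = (m - a) * (p * z1 powr (p - 1))"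
      using slope[of a m] ab m by auto
    obtain z2 where z2: "m < z2" "z2 < b" "b powr p - m powr p = (b - m) * (p * z2 powr (p - 1))"
      using slope[of m b] ab m by auto
    have "z1 powr (p - 1) < z2 powr (p - 1)"
      using z1 z2 ab p by (intro powr_less_mono2) auto
    then have "m powr p - a powr p < b powr p - m powr p"
      unfolding z1 z2 m(3,4) using ab p by simp
    then show ?thesis unfolding m_def by simp
  qed
  have tri: "\<bar>(x + y) / 2\<bar> powr p \<le> ((\<bar>x\<bar> + \<bar>y\<bar>) / 2) powr p"
    using p by (intro powr_mono2) auto
  consider "\<bar>x\<bar> < \<bar>y\<bar>" | "\<bar>y\<bar> < \<bar>x\<bar>" | "\<bar>x\<bar> = \<bar>y\<bar>" by linarith
  then show ?thesis
  proof cases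
    case 1 then show ?thesis using strict[of "\<bar>x\<bar>" "\<bar>y\<bar>"] tri by simp
  next
    case 2 then show ?thesis using strict[of "\<bar>y\<bar>" "\<bar>x\<bar>"] tri by (simp add: add.commute)
  next
    case 3
    then have "y = - x" "x \<noteq> 0" using ne by linarith+
    then show ?thesis by simp
  qed
qed

lemma abs_powr_midpoint:
  fixes x y p :: real
  assumes "1 \<le> p"
  shows "\<bar>(x + y) / 2\<bar> powr p \<le> (\<bar>x\<bar> powr p + \<bar>y\<bar> powr p) / 2"
proof -
  consider "p = 1" | "x = y" | "1 < p" "x \<noteq> y" using assms by linarith
  then show ?thesis
  proof cases
    case 1
    then show ?thesis using abs_triangle_ineq[of x y] by (simp add: field_simps)
  qed (use less_imp_le[OF abs_powr_midpoint_strict] in auto)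
qed

text \<open>
  The embedding of \<open>l\<^sup>p\<close> into \<open>l\<^sup>2\<close>: split each square as \<open>\<bar>x i\<bar> powr p * \<bar>x i\<bar> powr (2 - p)\<close>
  and bound the second factor through the whole sum, which dominates every term.
\<close>

lemma sum_squares_le_sum_powr:
  fixes x :: "'i \<Rightarrow> real"
  assumes p: "1 \<le> p" "p \<le> 2" and F: "finite F"
  shows "(\<Sum>i\<in>F. (x i)\<^sup>2) \<le> (\<Sum>i\<in>F. \<bar>x i\<bar> powr p) powr (2 / p)"
proof -
  define A where "A = (\<Sum>i\<in>F. \<bar>x i\<bar> powr p)"
  have A0: "0 \<le> A" unfolding A_def by (intro sum_nonneg) auto
  have term_le: "(x i)\<^sup>2 \<le> \<bar>x i\<bar> powr p * A powr ((2 - p) / p)" if i: "i \<in> F" for i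
  proof (cases "x i = 0")
    case False
    have "\<bar>x i\<bar> powr p \<le> A" unfolding A_def using F i by (intro member_le_sum) auto
    then have "(\<bar>x i\<bar> powr p) powr ((2 - p) / p) \<le> A powr ((2 - p) / p)"
      using p by (intro powr_mono2) auto
    then have "\<bar>x i\<bar> powr (2 - p) \<le> A powr ((2 - p) / p)"
      using p by (simp add: powr_powr)
    then have "\<bar>x i\<bar> powr p * \<bar>x i\<bar> powr (2 - p) \<le> \<bar>x i\<bar> powr p * A powr ((2 - p) / p)"
      by (intro mult_left_mono) auto
    moreover have "\<bar>x i\<bar> powr p * \<bar>x i\<bar> powr (2 - p) = (x i)\<^sup>2"
      using False by (simp flip: powr_add)
    ultimately show ?thesis by simp
  qed auto
  have "(\<Sum>i\<in>F. (x i)\<^sup>2) \<le> (\<Sum>i\<in>F. \<bar>x i\<bar> powr p * A powr ((2 - p) / p))"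
    by (intro sum_mono term_le)
  also have "\<dots> = A * A powr ((2 - p) / p)" by (simp add: A_def sum_distrib_right)
  also have "\<dots> = A powr (2 / p)"
  proof (cases "A = 0")
    case False
    then have "A * A powr ((2 - p) / p) = A powr (1 + (2 - p) / p)"
      using A0 by (simp add: powr_add)
    also have "1 + (2 - p) / p = 2 / p" using p by (simp add: field_simps)
    finally show ?thesis .
  qed auto
  finally show ?thesis unfolding A_def .
qed

section \<open>Norm bounds from coordinates\<close>

text \<open>
  The nontrivial half of Parseval's identity, by duality: Cauchy-Schwarz on the coefficients bounds
  \<open>f \<bullet> s\<close> for \<open>s\<close> in the span, density extends the bound to all \<open>s\<close>, and \<open>s = f\<close> gives the claim.
\<close>

lemma orthonormal_basis_norm_le:
  fixes \<phi> :: "'i \<Rightarrow> 'a::real_inner"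
  assumes basis: "orthonormal_basis_on \<Gamma> \<phi>" and B: "0 \<le> B"
    and partial: "\<And>F. finite F \<Longrightarrow> F \<subseteq> \<Gamma> \<Longrightarrow> (\<Sum>\<gamma>\<in>F. (f \<bullet> \<phi> \<gamma>)\<^sup>2) \<le> B\<^sup>2"
  shows "norm f \<le> B"
proof -
  have "f \<bullet> s \<le> B * norm s" if s_span: "s \<in> span (\<phi> ` \<Gamma>)" for s
  proof -
    obtain t r where t: "finite t" "t \<subseteq> \<phi> ` \<Gamma>" and s: "s = (\<Sum>v\<in>t. r v *\<^sub>R v)"
      using s_span unfolding span_explicit by blast
    obtain F where F: "F \<subseteq> \<Gamma>" "inj_on \<phi> F" "t = \<phi> ` F"
      using t(2) unfolding subset_image_inj by auto
    have finF: "finite F" using t(1) F(2,3) finite_image_iff by blast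
    define a where "a = r \<circ> \<phi>"
    have s': "s = (\<Sum>\<gamma>\<in>F. a \<gamma> *\<^sub>R \<phi> \<gamma>)"
      unfolding s F(3) a_def by (simp add: sum.reindex[OF F(2)])
    have ortho: "\<phi> i \<bullet> \<phi> \<gamma> = (if i = \<gamma> then 1 else 0)" if "i \<in> F" "\<gamma> \<in> F" for i \<gamma>
      using basis F(1) that unfolding orthonormal_basis_on_def by blast
    have coef: "\<phi> i \<bullet> s = a i" if "i \<in> F" for i
      unfolding s' using finF that by (simp add: inner_sum_right ortho if_distrib cong: if_cong)
    have "(norm s)\<^sup>2 = (\<Sum>\<gamma>\<in>F. (a \<gamma>)\<^sup>2)"
      unfolding power2_norm_eq_inner by (subst s') (simp add: inner_sum_left coef power2_eq_square)
    then have ns: "L2_set a F = norm s"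
      unfolding L2_set_def by (metis norm_ge_zero real_sqrt_unique)
    have "f \<bullet> s = (\<Sum>\<gamma>\<in>F. (f \<bullet> \<phi> \<gamma>) * a \<gamma>)"
      unfolding s' by (simp add: inner_sum_right mult.commute)
    also have "\<dots> \<le> (\<Sum>\<gamma>\<in>F. \<bar>f \<bullet> \<phi> \<gamma>\<bar> * \<bar>a \<gamma>\<bar>)"
      by (intro sum_mono) (metis abs_ge_self abs_mult)
    also have "\<dots> \<le> L2_set (\<lambda>\<gamma>. f \<bullet> \<phi> \<gamma>) F * L2_set a F" by (rule L2_set_mult_ineq)
    also have "\<dots> \<le> B * norm s"
      unfolding ns using partial[OF finF F(1)] B
      by (intro mult_right_mono) (auto simp: L2_set_def intro: real_le_lsqrt)
    finally show ?thesis .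
  qed
  then have "span (\<phi> ` \<Gamma>) \<subseteq> {s. f \<bullet> s \<le> B * norm s}" by blast
  moreover have "closed {s. f \<bullet> s \<le> B * norm s}"
    by (intro closed_Collect_le continuous_intros)
  ultimately have "closure (span (\<phi> ` \<Gamma>)) \<subseteq> {s. f \<bullet> s \<le> B * norm s}"
    by (rule closure_minimal)
  then have "f \<bullet> f \<le> B * norm f"
    using basis unfolding orthonormal_basis_on_def by auto
  then show ?thesis
    using B by (cases "f = 0") (auto simp: power2_norm_eq_inner[symmetric] power2_eq_square)
qed

lemma inner_midpoint_left: "midpoint f h \<bullet> u = (f \<bullet> u + h \<bullet> u) / 2"
  for f h u :: "'a::real_inner"
  by (simp add: midpoint_def inner_add_left)

section \<open>The weighted penalty\<close>

lemma midpoint_residual: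
  fixes K :: "'u::real_vector \<Rightarrow> 'v::real_vector"
  assumes "linear K"
  shows "K (midpoint f h) - g = midpoint (K f - g) (K h - g)"
proof -
  have "K (midpoint f h) = midpoint (K f) (K h)"
    by (simp add: midpoint_def linear_add[OF assms] linear_scale[OF assms])
  moreover have "midpoint a b - g = midpoint (a - g) (b - g)" for a b
    by (rule sym) (simp add: midpoint_eq_iff add_diff_add diff_add_eq_diff_diff_swap)
  ultimately show ?thesis by simp
qed

lemma norm_residual_midpoint_sq:
  fixes K :: "'u::real_vector \<Rightarrow> 'v::real_inner"
  assumes "linear K"
  shows "4 * (norm (K (midpoint f h) - g))\<^sup>2
    = 2 * (norm (K f - g))\<^sup>2 + 2 * (norm (K h - g))\<^sup>2 - (norm (K f - K h))\<^sup>2"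
  using norm_midpoint_sq[of "K f - g" "K h - g"]
  by (simp add: midpoint_residual[OF assms] field_simps)

lemma ennpowr_less_iff:
  assumes "0 < r"
  shows "ennpowr x r < ennpowr y r \<longleftrightarrow> x < y"
proof (cases x; cases y)
  fix a b assume "0 \<le> a" "x = ennreal a" "0 \<le> b" "y = ennreal b"
  moreover have "a powr r < b powr r \<longleftrightarrow> a < b"
    using calculation assms by (meson not_less powr_less_mono2 powr_mono2 less_imp_le)
  ultimately show ?thesis by (simp add: ennpowr_def ennreal_less_iff)
qed (use assms in \<open>auto simp: ennpowr_def\<close>)

locale weighted_lp_penalty =
  fixes \<Gamma> :: "'i set" and \<phi> :: "'i \<Rightarrow> 'a::{real_inner, complete_space}"
    and w :: "'i \<Rightarrow> real" and p c :: real
  assumes basis: "orthonormal_basis_on \<Gamma> \<phi>"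
    and p_ge: "1 \<le> p" and p_le: "p \<le> 2"
    and c_pos: "0 < c" and w_ge: "\<And>\<gamma>. \<gamma> \<in> \<Gamma> \<Longrightarrow> c \<le> w \<gamma>"
begin

text \<open>
  The \<open>p\<close>-th power of the weighted norm.
\<close>

definition penalty :: "'a \<Rightarrow> ennreal" where
  "penalty f = (\<Sum>\<^sub>\<infinity>\<gamma>\<in>\<Gamma>. ennreal (w \<gamma> * \<bar>f \<bullet> \<phi> \<gamma>\<bar> powr p))"

definition partial_penalty :: "'i set \<Rightarrow> 'a \<Rightarrow> real" where
  "partial_penalty F f = (\<Sum>\<gamma>\<in>F. w \<gamma> * \<bar>f \<bullet> \<phi> \<gamma>\<bar> powr p)"

lemma p_pos: "0 < p" using p_ge by simp

lemma w_pos: "\<gamma> \<in> \<Gamma> \<Longrightarrow> 0 < w \<gamma>"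
  using w_ge c_pos by (meson less_le_trans)

lemma partial_penalty_empty [simp]: "partial_penalty {} f = 0"
  by (simp add: partial_penalty_def)

lemma partial_penalty_nonneg: "F \<subseteq> \<Gamma> \<Longrightarrow> 0 \<le> partial_penalty F f"
  unfolding partial_penalty_def using w_pos by (intro sum_nonneg mult_nonneg_nonneg) (auto intro: less_imp_le)

lemma partial_penalty_mono:
  "finite G \<Longrightarrow> G \<subseteq> \<Gamma> \<Longrightarrow> F \<subseteq> G \<Longrightarrow> partial_penalty F f \<le> partial_penalty G f"
  unfolding partial_penalty_def
  using w_pos by (intro sum_mono2 mult_nonneg_nonneg) (auto intro: less_imp_le)

lemma partial_penalty_Diff:
  assumes "finite F" "finite G"
  shows "partial_penalty (G - F) f = partial_penalty (F \<union> G) f - partial_penalty F f"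
  using sum.subset_diff[of F "F \<union> G" "\<lambda>\<gamma>. w \<gamma> * \<bar>f \<bullet> \<phi> \<gamma>\<bar> powr p"] assms
  unfolding partial_penalty_def by (simp add: Un_Diff)

lemma continuous_on_partial_penalty: "continuous_on A (partial_penalty F)"
  unfolding partial_penalty_def [abs_def] using p_pos
  by (intro continuous_on_sum continuous_on_mult continuous_on_const continuous_on_powr')
     (auto intro!: continuous_intros)

lemma penalty_eq_SUP:
  "penalty f = (SUP F\<in>{F. finite F \<and> F \<subseteq> \<Gamma>}. ennreal (partial_penalty F f))"
proof -
  have "(\<Sum>\<gamma>\<in>F. ennreal (w \<gamma> * \<bar>f \<bullet> \<phi> \<gamma>\<bar> powr p)) = ennreal (partial_penalty F f)"
    if "F \<subseteq> \<Gamma>" for F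
    unfolding partial_penalty_def using that w_pos
    by (intro sum_ennreal mult_nonneg_nonneg) (auto intro: less_imp_le)
  then show ?thesis
    unfolding penalty_def by (subst nonneg_infsum_complete) (auto intro!: SUP_cong)
qed

lemma partial_penalty_le_penalty:
  "finite F \<Longrightarrow> F \<subseteq> \<Gamma> \<Longrightarrow> ennreal (partial_penalty F f) \<le> penalty f"
  unfolding penalty_eq_SUP by (intro SUP_upper) auto

lemma penalty_le_iff:
  assumes "0 \<le> t"
  shows "penalty f \<le> ennreal t \<longleftrightarrow> (\<forall>F. finite F \<and> F \<subseteq> \<Gamma> \<longrightarrow> partial_penalty F f \<le> t)"
  unfolding penalty_eq_SUP SUP_le_iff using assms by auto

lemma objective_eq: "\<Phi> K \<Gamma> \<phi> w p m g f = ennreal ((norm (K f - g))\<^sup>2) + ennreal m * penalty f"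
  unfolding \<Phi>_def ennpowr_wp_norm[OF p_pos] penalty_def ..

text \<open>
  Since the penalty is a supremum of real partial sums, an upper bound on the extended-real
  objective is a family of real inequalities; convexity and continuity are checked on these.
\<close>

lemma objective_le_iff:
  assumes m: "0 < m" and t: "0 \<le> t"
  shows "\<Phi> K \<Gamma> \<phi> w p m g f \<le> ennreal t \<longleftrightarrow>
    (\<forall>F. finite F \<and> F \<subseteq> \<Gamma> \<longrightarrow> (norm (K f - g))\<^sup>2 + m * partial_penalty F f \<le> t)"
    (is "?L \<longleftrightarrow> ?R")
proof
  assume ?L
  show ?R
  proof (intro allI impI, elim conjE)
    fix F assume F: "finite F" "F \<subseteq> \<Gamma>"
    have "ennreal ((norm (K f - g))\<^sup>2 + m * partial_penalty F f)
        = ennreal ((norm (K f - g))\<^sup>2) + ennreal m * ennreal (partial_penalty F f)"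
      using m partial_penalty_nonneg[OF F(2)] by (simp add: ennreal_mult)
    also have "\<dots> \<le> \<Phi> K \<Gamma> \<phi> w p m g f"
      unfolding objective_eq by (intro add_left_mono mult_left_mono partial_penalty_le_penalty F) auto
    also note \<open>?L\<close>
    finally show "(norm (K f - g))\<^sup>2 + m * partial_penalty F f \<le> t"
      using t by (subst (asm) ennreal_le_iff) auto
  qed
next
  assume R: ?R
  define a where "a = (norm (K f - g))\<^sup>2"
  have a: "0 \<le> a" "a \<le> t" using R[rule_format, of "{}"] by (auto simp: a_def)
  have "penalty f \<le> ennreal ((t - a) / m)"
    using R a m by (subst penalty_le_iff) (auto simp: a_def field_simps)
  then have "\<Phi> K \<Gamma> \<phi> w p m g f \<le> ennreal a + ennreal m * ennreal ((t - a) / m)"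
    unfolding objective_eq a_def by (intro add_left_mono mult_left_mono) auto
  also have "\<dots> = ennreal t"
    using a m by (simp flip: ennreal_mult ennreal_plus)
  finally show ?L .
qed

lemma sum_squares_le_partial_penalty:
  assumes F: "finite F" "F \<subseteq> \<Gamma>" and t: "partial_penalty F f \<le> t"
  shows "(\<Sum>\<gamma>\<in>F. (f \<bullet> \<phi> \<gamma>)\<^sup>2) \<le> (t / c) powr (2 / p)"
proof -
  have "c * (\<Sum>\<gamma>\<in>F. \<bar>f \<bullet> \<phi> \<gamma>\<bar> powr p) \<le> partial_penalty F f"
    unfolding partial_penalty_def sum_distrib_left
    using F w_ge by (intro sum_mono mult_right_mono) auto
  then have "(\<Sum>\<gamma>\<in>F. \<bar>f \<bullet> \<phi> \<gamma>\<bar> powr p) \<le> t / c"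
    using t c_pos by (simp add: field_simps)
  then have "(\<Sum>\<gamma>\<in>F. \<bar>f \<bullet> \<phi> \<gamma>\<bar> powr p) powr (2 / p) \<le> (t / c) powr (2 / p)"
    using p_pos by (intro powr_mono2 sum_nonneg) auto
  with sum_squares_le_sum_powr[OF p_ge p_le F(1)] show ?thesis
    by (rule order_trans)
qed

lemma norm_le_penalty:
  assumes t: "0 \<le> t" and le: "penalty f \<le> ennreal t"
  shows "norm f \<le> (t / c) powr (1 / p)"
proof (rule orthonormal_basis_norm_le[OF basis])
  fix F assume F: "finite F" "F \<subseteq> \<Gamma>"
  then have "(\<Sum>\<gamma>\<in>F. (f \<bullet> \<phi> \<gamma>)\<^sup>2) \<le> (t / c) powr (2 / p)"
    using le t penalty_le_iff sum_squares_le_partial_penalty by blast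
  also have "\<dots> = ((t / c) powr (1 / p))\<^sup>2"
    by (simp add: power2_eq_square flip: powr_add)
  finally show "(\<Sum>\<gamma>\<in>F. (f \<bullet> \<phi> \<gamma>)\<^sup>2) \<le> ((t / c) powr (1 / p))\<^sup>2" .
qed simp

lemma partial_penalty_midpoint:
  assumes "F \<subseteq> \<Gamma>"
  shows "partial_penalty F (midpoint f h) \<le> (partial_penalty F f + partial_penalty F h) / 2"
proof -
  have "partial_penalty F (midpoint f h)
      \<le> (\<Sum>\<gamma>\<in>F. w \<gamma> * ((\<bar>f \<bullet> \<phi> \<gamma>\<bar> powr p + \<bar>h \<bullet> \<phi> \<gamma>\<bar> powr p) / 2))"
    unfolding partial_penalty_def inner_midpoint_left using assms w_pos
    by (intro sum_mono mult_left_mono abs_powr_midpoint p_ge) (auto intro: less_imp_le)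
  also have "\<dots> = (partial_penalty F f + partial_penalty F h) / 2"
    unfolding partial_penalty_def
    by (simp add: sum_divide_distrib sum.distrib distrib_left add_divide_distrib)
  finally show ?thesis .
qed

text \<open>
  The gain from strict convexity in one coordinate \<open>\<gamma>\<close> is the same for all finite index sets containing
  \<open>\<gamma>\<close>, so it survives the passage to the supremum.
\<close>

lemma partial_penalty_midpoint_gap:
  assumes p: "1 < p" and \<gamma>: "\<gamma> \<in> \<Gamma>" and ne: "f \<bullet> \<phi> \<gamma> \<noteq> h \<bullet> \<phi> \<gamma>"
  obtains d where "0 < d"
    "\<And>F. finite F \<Longrightarrow> F \<subseteq> \<Gamma> \<Longrightarrow> \<gamma> \<in> F \<Longrightarrow>
      partial_penalty F (midpoint f h) \<le> (partial_penalty F f + partial_penalty F h) / 2 - d"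
proof
  define d where "d = (partial_penalty {\<gamma>} f + partial_penalty {\<gamma>} h) / 2
    - partial_penalty {\<gamma>} (midpoint f h)"
  have "w \<gamma> * \<bar>(f \<bullet> \<phi> \<gamma> + h \<bullet> \<phi> \<gamma>) / 2\<bar> powr p
      < w \<gamma> * ((\<bar>f \<bullet> \<phi> \<gamma>\<bar> powr p + \<bar>h \<bullet> \<phi> \<gamma>\<bar> powr p) / 2)"
    using abs_powr_midpoint_strict[OF p ne] w_pos[OF \<gamma>] by (rule mult_strict_left_mono)
  then show "0 < d"
    unfolding d_def partial_penalty_def inner_midpoint_left by (simp add: distrib_left add_divide_distrib)
  fix F assume F: "finite F" "F \<subseteq> \<Gamma>" "\<gamma> \<in> F"
  have split: "partial_penalty F u = partial_penalty {\<gamma>} u + partial_penalty (F - {\<gamma>}) u" for u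
    unfolding partial_penalty_def using F by (simp add: sum.remove)
  have "partial_penalty (F - {\<gamma>}) (midpoint f h)
      \<le> (partial_penalty (F - {\<gamma>}) f + partial_penalty (F - {\<gamma>}) h) / 2"
    using F by (intro partial_penalty_midpoint) auto
  then show "partial_penalty F (midpoint f h) \<le> (partial_penalty F f + partial_penalty F h) / 2 - d"
    unfolding d_def split[of "midpoint f h"] split[of f] split[of h] by argo
qed

lemma closed_penalty_sublevel: "0 \<le> t \<Longrightarrow> closed {f. penalty f \<le> ennreal t}"
  by (simp only: penalty_le_iff)
     (intro closed_Collect_all closed_Collect_imp open_Collect_const closed_Collect_le
       continuous_on_partial_penalty continuous_on_const)

lemma bounded_penalty_sublevel: "0 \<le> t \<Longrightarrow> bounded {f. penalty f \<le> ennreal t}"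
  using norm_le_penalty unfolding bounded_iff by blast

lemma penalty_midpoint_le:
  assumes t: "0 \<le> t" and fh: "penalty f \<le> ennreal t" "penalty h \<le> ennreal t"
  shows "penalty (midpoint f h) \<le> ennreal t"
  unfolding penalty_le_iff[OF t]
proof (intro allI impI, elim conjE)
  fix F assume F: "finite F" "F \<subseteq> \<Gamma>"
  have "partial_penalty F f \<le> t" "partial_penalty F h \<le> t"
    using fh F unfolding penalty_le_iff[OF t] by blast+
  then show "partial_penalty F (midpoint f h) \<le> t"
    using partial_penalty_midpoint[OF F(2), of f h] by argo
qed

section \<open>Existence and uniqueness of minimizers\<close>

text \<open>
  Minimization over a closed convex set rather than the whole space, so that both the
  regularized problem and the problem defining \<open>f\<^sup>\<dagger>\<close> are instances.
\<close>

lemma ex1_objective_minimizer: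
  fixes K :: "'a \<Rightarrow> 'b::real_inner"
  assumes K: "bounded_linear K" and inj: "1 < p \<or> null_space K = {0}" and m: "0 < m"
    and S: "closed S" "convex S" and f0: "f0 \<in> S" "\<Phi> K \<Gamma> \<phi> w p m g f0 < \<infinity>"
  shows "\<exists>!f. is_arg_min (\<Phi> K \<Gamma> \<phi> w p m g) (\<lambda>f. f \<in> S) f"
proof (rule ex_ex1I)
  let ?J = "\<Phi> K \<Gamma> \<phi> w p m g"
  have lin: "linear K" using K by (rule bounded_linear.linear)
  have mid_le: "2 * (m * partial_penalty F (midpoint f h))
      \<le> m * partial_penalty F f + m * partial_penalty F h" if "F \<subseteq> \<Gamma>" for F f h
    using mult_left_mono[OF partial_penalty_midpoint[OF that], of m f h] m by (simp add: distrib_left)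
  show "\<exists>f. is_arg_min ?J (\<lambda>f. f \<in> S) f"
  proof (rule convex_lsc_coercive_attains_min[where J = ?J and ?f0.0 = f0])
    fix t :: real assume t: "0 \<le> t"
    show "closed {f. ?J f \<le> ennreal t}"
      unfolding objective_le_iff[OF m t]
      by (intro closed_Collect_all closed_Collect_imp open_Collect_const closed_Collect_le
          continuous_intros continuous_on_partial_penalty bounded_linear.continuous_on[OF K])
    have "{f. ?J f \<le> ennreal t} \<subseteq> {f. penalty f \<le> ennreal (t / m)}"
    proof clarify
      fix f assume J: "?J f \<le> ennreal t"
      show "penalty f \<le> ennreal (t / m)"
        using m t
      proof (subst penalty_le_iff; clarsimp)
        fix F assume "finite F" "F \<subseteq> \<Gamma>"
        then have "(norm (K f - g))\<^sup>2 + m * partial_penalty F f \<le> t"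
          using J unfolding objective_le_iff[OF m t] by blast
        then have "m * partial_penalty F f \<le> t" using zero_le_power2[of "norm (K f - g)"] by linarith
        then show "partial_penalty F f \<le> t / m" using m by (simp add: field_simps)
      qed
    qed
    then show "bounded {f. ?J f \<le> ennreal t}"
      using m t by (intro bounded_subset[OF bounded_penalty_sublevel[of "t / m"]]) auto
    fix f h assume fh: "?J f \<le> ennreal t" "?J h \<le> ennreal t"
    show "?J (midpoint f h) \<le> ennreal t"
      unfolding objective_le_iff[OF m t]
    proof (intro allI impI, elim conjE)
      fix F assume F: "finite F" "F \<subseteq> \<Gamma>"
      have "(norm (K f - g))\<^sup>2 + m * partial_penalty F f \<le> t"
        "(norm (K h - g))\<^sup>2 + m * partial_penalty F h \<le> t"
        using fh F unfolding objective_le_iff[OF m t] by blast+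
      moreover have "0 \<le> (norm (K f - K h))\<^sup>2" by simp
      ultimately show "(norm (K (midpoint f h) - g))\<^sup>2 + m * partial_penalty F (midpoint f h) \<le> t"
        using mid_le[OF F(2), of f h] norm_residual_midpoint_sq[OF lin, of f h g] by linarith
    qed
  qed (use S f0 in auto)
  fix f h assume f: "is_arg_min ?J (\<lambda>f. f \<in> S) f" and h: "is_arg_min ?J (\<lambda>f. f \<in> S) h"
  show "f = h"
  proof (rule ccontr)
    assume ne: "f \<noteq> h"
    have min: "f \<in> S" "h \<in> S" "\<And>y. y \<in> S \<Longrightarrow> ?J f \<le> ?J y" "\<And>y. y \<in> S \<Longrightarrow> ?J h \<le> ?J y"
      using f h unfolding is_arg_min_def by (auto simp: not_less)
    have "?J f < \<infinity>" using min(3)[OF f0(1)] f0(2) by (rule le_less_trans)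
    then obtain t where t: "0 \<le> t" "?J f = ennreal t" by (cases "?J f") auto
    have t': "?J h = ennreal t" using min t by (metis antisym)
    have mid: "midpoint f h \<in> S"
      using min(1,2) S(2) unfolding midpoint_def by (auto simp: scaleR_add_right intro: convexD)
    have "?J f \<le> ennreal t" "?J h \<le> ennreal t" using t t' by auto
    then have le_f: "(norm (K f - g))\<^sup>2 + m * partial_penalty F f \<le> t"
      and le_h: "(norm (K h - g))\<^sup>2 + m * partial_penalty F h \<le> t"
      if "finite F" "F \<subseteq> \<Gamma>" for F
      using that unfolding objective_le_iff[OF m t(1)] by blast+
    \<comment> \<open>The midpoint lowers the objective by at least \<open>d\<close>: through the residual if \<open>K f\<close> and \<open>K h\<close> differ, otherwise through the penalty.\<close>
    obtain d where d: "0 < d" and gap: "\<And>F. finite F \<Longrightarrow> F \<subseteq> \<Gamma> \<Longrightarrow>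
        (norm (K (midpoint f h) - g))\<^sup>2 + m * partial_penalty F (midpoint f h) \<le> t - d"
    proof (cases "K f = K h")
      case False
      show ?thesis
      proof (rule that[of "(norm (K f - K h))\<^sup>2 / 4"])
        show "0 < (norm (K f - K h))\<^sup>2 / 4" using False by simp
        fix F assume F: "finite F" "F \<subseteq> \<Gamma>"
        show "(norm (K (midpoint f h) - g))\<^sup>2 + m * partial_penalty F (midpoint f h)
            \<le> t - (norm (K f - K h))\<^sup>2 / 4"
          using mid_le[OF F(2), of f h] le_f[OF F] le_h[OF F]
            norm_residual_midpoint_sq[OF lin, of f h g] by linarith
      qed
    next
      case True
      then have "f - h \<in> null_space K" by (simp add: null_space_def linear_diff[OF lin])
      then have "null_space K \<noteq> {0}" using ne by (metis right_minus_eq singletonD)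
      then have p: "1 < p" using inj by blast
      have "\<exists>\<gamma>\<in>\<Gamma>. f \<bullet> \<phi> \<gamma> \<noteq> h \<bullet> \<phi> \<gamma>"
      proof (rule ccontr)
        assume "\<not> ?thesis"
        then have "norm (f - h) \<le> 0"
          by (intro orthonormal_basis_norm_le[OF basis])
             (auto simp: inner_diff_left subset_iff intro!: sum_nonpos)
        then show False using ne by simp
      qed
      then obtain \<gamma> where \<gamma>: "\<gamma> \<in> \<Gamma>" "f \<bullet> \<phi> \<gamma> \<noteq> h \<bullet> \<phi> \<gamma>" by blast
      obtain d where d: "0 < d" "\<And>F. finite F \<Longrightarrow> F \<subseteq> \<Gamma> \<Longrightarrow> \<gamma> \<in> F \<Longrightarrow>
          partial_penalty F (midpoint f h) \<le> (partial_penalty F f + partial_penalty F h) / 2 - d"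
        using partial_penalty_midpoint_gap[OF p \<gamma>] by blast
      show ?thesis
      proof (rule that[of "m * d"])
        show "0 < m * d" using m d by simp
        fix F assume F: "finite F" "F \<subseteq> \<Gamma>"
        \<comment> \<open>The gap is only available for index sets that contain \<open>\<gamma>\<close>.\<close>
        let ?G = "insert \<gamma> F"
        have G: "finite ?G" "?G \<subseteq> \<Gamma>" "\<gamma> \<in> ?G" using F \<gamma> by auto
        have "partial_penalty F (midpoint f h) \<le> partial_penalty ?G (midpoint f h)"
          using G by (intro partial_penalty_mono) auto
        also have "\<dots> \<le> (partial_penalty ?G f + partial_penalty ?G h) / 2 - d"
          by (rule d(2)[OF G])
        finally have "2 * (m * partial_penalty F (midpoint f h))
            \<le> 2 * (m * ((partial_penalty ?G f + partial_penalty ?G h) / 2 - d))"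
          using m by simp
        also have "\<dots> = m * partial_penalty ?G f + m * partial_penalty ?G h - 2 * (m * d)"
          by (simp add: field_simps)
        finally have "2 * (m * partial_penalty F (midpoint f h))
            \<le> m * partial_penalty ?G f + m * partial_penalty ?G h - 2 * (m * d)" .
        then show "(norm (K (midpoint f h) - g))\<^sup>2 + m * partial_penalty F (midpoint f h) \<le> t - m * d"
          using le_f[OF G(1,2)] le_h[OF G(1,2)] norm_residual_midpoint_sq[OF lin, of f h g] True by simp
      qed
    qed
    have td: "0 \<le> t - d"
      using order_trans[OF zero_le_power2 gap[of "{}", simplified]] by simp
    then have "?J (midpoint f h) \<le> ennreal (t - d)"
      using gap by (subst objective_le_iff[OF m]) auto
    also have "\<dots> < ennreal t" using td d by (simp add: ennreal_less_iff)
    finally show False using min(3)[OF mid] t(2) by simp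
  qed
qed

section \<open>Convergence of near-minimal elements\<close>

text \<open>
  If \<open>\<delta> \<le> (f x - f0) \<bullet> v\<close> held frequently, the sets \<open>C n\<close> of points in this half-space with
  residual and penalty excess at most \<open>1 / Suc n\<close> would all be nonempty. A point common to them has
  the image of \<open>f0\<close> under \<open>K\<close> and penalty at most \<open>q\<close>, so by uniqueness it is \<open>f0\<close>, which lies
  outside the half-space. Both signs of \<open>u\<close> give the limit.
\<close>

lemma weak_tendsto_of_near_minimal:
  fixes K :: "'a \<Rightarrow> 'b::real_normed_vector"
  assumes K: "bounded_linear K" and q: "0 \<le> q"
    and unique: "\<And>h. K h = K f0 \<Longrightarrow> penalty h \<le> ennreal q \<Longrightarrow> h = f0"
    and residual: "((\<lambda>x. K (f x)) \<longlongrightarrow> K f0) G"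
    and near: "\<And>\<tau>. 0 < \<tau> \<Longrightarrow> \<forall>\<^sub>F x in G. penalty (f x) \<le> ennreal (q + \<tau>)"
  shows "((\<lambda>x. f x \<bullet> u) \<longlongrightarrow> f0 \<bullet> u) G"
proof -
  have half: "\<forall>\<^sub>F x in G. (f x - f0) \<bullet> v < \<delta>" if \<delta>: "0 < \<delta>" for v \<delta>
  proof (rule ccontr)
    assume "\<not> ?thesis"
    then have freq: "\<exists>\<^sub>F x in G. \<delta> \<le> (f x - f0) \<bullet> v"
      by (simp add: not_eventually not_less)
    define C where "C n = {h. norm (K h - K f0) \<le> 1 / Suc n} \<inter>
      {h. penalty h \<le> ennreal (q + 1 / Suc n)} \<inter> {h. \<delta> \<le> (h - f0) \<bullet> v}" for n
    have "(\<Inter>n. C n) \<noteq> {}"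
    proof (rule nested_midpoint_convex_Inter_nonempty)
      fix n
      have n: "0 < 1 / real (Suc n)" by simp
      have "\<forall>\<^sub>F x in G. norm (K (f x) - K f0) \<le> 1 / Suc n"
        using tendstoD[OF residual n] by eventually_elim (simp add: dist_norm)
      then have "\<forall>\<^sub>F x in G. norm (K (f x) - K f0) \<le> 1 / Suc n \<and> penalty (f x) \<le> ennreal (q + 1 / Suc n)"
        using near[OF n] by (rule eventually_conj)
      from frequently_ex[OF frequently_eventually_frequently[OF freq this]]
      show "C n \<noteq> {}" unfolding C_def by blast
      show "closed (C n)" unfolding C_def using q
        by (intro closed_Int closed_penalty_sublevel closed_Collect_le continuous_intros
            bounded_linear.continuous_on[OF K]) auto
      fix x y assume xy: "x \<in> C n" "y \<in> C n"
      have "K (midpoint x y) - K f0 = midpoint (K x - K f0) (K y - K f0)"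
        by (simp add: midpoint_residual bounded_linear.linear[OF K])
      then have "2 * norm (K (midpoint x y) - K f0) \<le> norm (K x - K f0) + norm (K y - K f0)"
        using norm_triangle_ineq[of "K x - K f0" "K y - K f0"] by (simp add: midpoint_def)
      moreover have "norm (K x - K f0) \<le> 1 / Suc n" "norm (K y - K f0) \<le> 1 / Suc n"
        using xy unfolding C_def by blast+
      ultimately have "norm (K (midpoint x y) - K f0) \<le> 1 / Suc n" by linarith
      moreover have "\<delta> \<le> (midpoint x y - f0) \<bullet> v"
        using xy unfolding C_def by (simp add: inner_diff_left inner_midpoint_left field_simps)
      moreover have "penalty (midpoint x y) \<le> ennreal (q + 1 / Suc n)"
        using xy q unfolding C_def by (intro penalty_midpoint_le) auto
      ultimately show "midpoint x y \<in> C n" unfolding C_def by blast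
    next
      show "decseq C" unfolding decseq_def
      proof (intro allI impI subsetI)
        fix m n h assume mn: "m \<le> n" and h: "h \<in> C n"
        have le: "1 / real (Suc n) \<le> 1 / Suc m" using mn by (intro divide_left_mono) auto
        then have "ennreal (q + 1 / Suc n) \<le> ennreal (q + 1 / Suc m)" by (intro ennreal_leI) simp
        then show "h \<in> C m" using h le unfolding C_def by (auto intro: order_trans simp del: ennreal_plus)
      qed
      show "bounded (C 0)" unfolding C_def
        using q bounded_penalty_sublevel[of "q + 1 / Suc 0"] by (intro bounded_Int) auto
    qed
    then obtain h where h: "\<And>n. h \<in> C n" by blast
    have lim: "(\<lambda>n. a + 1 / real (Suc n)) \<longlonglongrightarrow> a" for a :: real
      using tendsto_add[OF tendsto_const LIMSEQ_Suc[OF lim_1_over_n], of a] by simp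
    have "norm (K h - K f0) \<le> 0"
      using h unfolding C_def by (intro LIMSEQ_le_const[OF lim[of 0]]) auto
    moreover have "penalty h \<le> ennreal q"
      using h unfolding C_def
      by (intro LIMSEQ_le_const[OF tendsto_ennrealI[OF lim[of q]]]) auto
    ultimately have "h = f0" by (intro unique) auto
    then show False using h[of 0] \<delta> unfolding C_def by simp
  qed
  show ?thesis
  proof (rule tendstoI)
    fix \<delta> :: real assume "0 < \<delta>"
    from half[OF this, of u] half[OF this, of "- u"]
    show "\<forall>\<^sub>F x in G. dist (f x \<bullet> u) (f0 \<bullet> u) < \<delta>"
      by eventually_elim (auto simp: dist_real_def inner_diff_left)
  qed
qed

text \<open>
  The weighted \<open>l\<^sup>p\<close> analogue of the fact that weak convergence and convergence of norms imply norm
  convergence. Fix a finite \<open>F\<close> carrying all but \<open>\<tau>\<close> of the penalty of \<open>f0\<close>. Eventually \<open>f x\<close> has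
  penalty more than \<open>q - \<tau>\<close> on \<open>F\<close> and at most \<open>q + \<tau>\<close> in total, hence at most \<open>2 * \<tau>\<close> off \<open>F\<close>;
  this bounds the \<open>l\<^sup>2\<close> tails of both \<open>f x\<close> and \<open>f0\<close>. On \<open>F\<close> the difference tends to \<open>0\<close>
  coordinatewise.
\<close>

lemma penalty_radon_riesz:
  assumes q: "0 \<le> q" "penalty f0 = ennreal q"
    and coords: "\<And>\<gamma>. \<gamma> \<in> \<Gamma> \<Longrightarrow> ((\<lambda>x. f x \<bullet> \<phi> \<gamma>) \<longlongrightarrow> f0 \<bullet> \<phi> \<gamma>) G"
    and near: "\<And>\<tau>. 0 < \<tau> \<Longrightarrow> \<forall>\<^sub>F x in G. penalty (f x) \<le> ennreal (q + \<tau>)"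
  shows "(f \<longlongrightarrow> f0) G"
proof (rule tendstoI)
  fix e' :: real assume "0 < e'"
  define e where "e = e' / 2"
  have e: "0 < e" "e < e'" using \<open>0 < e'\<close> by (auto simp: e_def)
  \<comment> \<open>Chosen so that a penalty of at most \<open>2 * \<tau>\<close> off \<open>F\<close> means a squared norm of at most \<open>e\<^sup>2 / 8\<close>.\<close>
  define \<tau> where "\<tau> = c / 2 * (e\<^sup>2 / 8) powr (p / 2)"
  have \<tau>: "0 < \<tau>" using c_pos e by (simp add: \<tau>_def)
  have \<tau>_eq: "(2 * \<tau> / c) powr (2 / p) = e\<^sup>2 / 8"
    using c_pos e p_pos by (simp add: \<tau>_def powr_powr)
  have "\<exists>F. finite F \<and> F \<subseteq> \<Gamma> \<and> q - \<tau> < partial_penalty F f0"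
  proof (rule ccontr)
    assume "\<not> ?thesis"
    then have le: "\<And>F. finite F \<Longrightarrow> F \<subseteq> \<Gamma> \<Longrightarrow> partial_penalty F f0 \<le> q - \<tau>"
      by (meson not_less)
    then have "0 \<le> q - \<tau>" using le[of "{}"] by simp
    then have "penalty f0 \<le> ennreal (q - \<tau>)" using le by (subst penalty_le_iff) auto
    then show False using q \<tau> \<open>0 \<le> q - \<tau>\<close> by (simp add: ennreal_le_iff)
  qed
  then obtain F where F: "finite F" "F \<subseteq> \<Gamma>" "q - \<tau> < partial_penalty F f0" by blast
  have "((\<lambda>x. partial_penalty F (f x)) \<longlongrightarrow> partial_penalty F f0) G"
    unfolding partial_penalty_def using F(2) coords p_pos
    by (intro tendsto_sum tendsto_mult tendsto_const tendsto_powr' tendsto_rabs) auto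
  then have ev1: "\<forall>\<^sub>F x in G. q - \<tau> < partial_penalty F (f x)"
    using F(3) by (rule order_tendstoD)
  have "((\<lambda>x. \<Sum>\<gamma>\<in>F. ((f x - f0) \<bullet> \<phi> \<gamma>)\<^sup>2) \<longlongrightarrow> (\<Sum>\<gamma>\<in>F. (f0 \<bullet> \<phi> \<gamma> - f0 \<bullet> \<phi> \<gamma>)\<^sup>2)) G"
    unfolding inner_diff_left using F(2) coords
    by (intro tendsto_sum tendsto_power tendsto_diff tendsto_const) auto
  then have ev2: "\<forall>\<^sub>F x in G. (\<Sum>\<gamma>\<in>F. ((f x - f0) \<bullet> \<phi> \<gamma>)\<^sup>2) < e\<^sup>2 / 2"
    by (rule order_tendstoD) (use e in simp)
  from ev1 ev2 near[OF \<tau>]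
  show "\<forall>\<^sub>F x in G. dist (f x) f0 < e'"
  proof eventually_elim
    case (elim x)
    have "norm (f x - f0) \<le> e"
    proof (rule orthonormal_basis_norm_le[OF basis])
      fix H assume H: "finite H" "H \<subseteq> \<Gamma>"
      have HF: "finite (H - F)" "H - F \<subseteq> \<Gamma>" "finite (F \<union> H)" "F \<union> H \<subseteq> \<Gamma>" using H F by auto
      have tail: "(\<Sum>\<gamma>\<in>H - F. (g \<bullet> \<phi> \<gamma>)\<^sup>2) \<le> e\<^sup>2 / 8"
        if g: "penalty g \<le> ennreal (q + \<tau>)" "q - \<tau> < partial_penalty F g" for g
      proof -
        have "partial_penalty (F \<union> H) g \<le> q + \<tau>"
          using g(1) HF q \<tau> penalty_le_iff[of "q + \<tau>" g] by auto
        then have "partial_penalty (H - F) g \<le> 2 * \<tau>"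
          using g(2) unfolding partial_penalty_Diff[OF F(1) H(1)] by simp
        from sum_squares_le_partial_penalty[OF HF(1,2) this] show ?thesis unfolding \<tau>_eq .
      qed
      have sq: "(a - b)\<^sup>2 \<le> 2 * a\<^sup>2 + 2 * b\<^sup>2" for a b :: real
        using zero_le_power2[of "a + b"] by (simp add: power2_sum power2_diff)
      have "(\<Sum>\<gamma>\<in>H - F. ((f x - f0) \<bullet> \<phi> \<gamma>)\<^sup>2)
          \<le> (\<Sum>\<gamma>\<in>H - F. 2 * (f x \<bullet> \<phi> \<gamma>)\<^sup>2 + 2 * (f0 \<bullet> \<phi> \<gamma>)\<^sup>2)"
        unfolding inner_diff_left by (intro sum_mono sq)
      also have "\<dots> = 2 * (\<Sum>\<gamma>\<in>H - F. (f x \<bullet> \<phi> \<gamma>)\<^sup>2) + 2 * (\<Sum>\<gamma>\<in>H - F. (f0 \<bullet> \<phi> \<gamma>)\<^sup>2)"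
        by (simp add: sum.distrib sum_distrib_left)
      also have "\<dots> \<le> e\<^sup>2 / 2"
        using tail[of "f x"] tail[of f0] elim F(3) q \<tau> by (simp add: ennreal_leI)
      finally have "(\<Sum>\<gamma>\<in>H - F. ((f x - f0) \<bullet> \<phi> \<gamma>)\<^sup>2) \<le> e\<^sup>2 / 2" .
      moreover have "(\<Sum>\<gamma>\<in>H. ((f x - f0) \<bullet> \<phi> \<gamma>)\<^sup>2) \<le> (\<Sum>\<gamma>\<in>F \<union> H. ((f x - f0) \<bullet> \<phi> \<gamma>)\<^sup>2)"
        using HF by (intro sum_mono2) auto
      moreover have "(\<Sum>\<gamma>\<in>F \<union> H. ((f x - f0) \<bullet> \<phi> \<gamma>)\<^sup>2)
          = (\<Sum>\<gamma>\<in>F. ((f x - f0) \<bullet> \<phi> \<gamma>)\<^sup>2) + (\<Sum>\<gamma>\<in>H - F. ((f x - f0) \<bullet> \<phi> \<gamma>)\<^sup>2)"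
        using sum.union_disjoint[of F "H - F"] F(1) HF(1) by (metis Diff_disjoint Un_Diff_cancel)
      ultimately show "(\<Sum>\<gamma>\<in>H. ((f x - f0) \<bullet> \<phi> \<gamma>)\<^sup>2) \<le> e\<^sup>2"
        using elim(2) by linarith
    qed (use e in simp)
    then show ?case using e by (simp add: dist_norm)
  qed
qed

section \<open>Comparison of the two minimization problems\<close>

text \<open>
  On the solution set the residual for the data \<open>K f\<^sub>o\<close> vanishes, so the objective with unit
  parameter is the penalty, of which the weighted norm is a strictly increasing function.
\<close>

lemma is_arg_min_wp_norm_iff:
  "is_arg_min (wp_norm \<Gamma> \<phi> w p) (\<lambda>f. f \<in> solution_set K f\<^sub>o) f \<longleftrightarrow>
   is_arg_min (\<Phi> K \<Gamma> \<phi> w p 1 (K f\<^sub>o)) (\<lambda>f. f \<in> solution_set K f\<^sub>o) f"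
proof -
  have "wp_norm \<Gamma> \<phi> w p f = ennpowr (penalty f) (1 / p)" for f
    unfolding wp_norm_def penalty_def ..
  then have "wp_norm \<Gamma> \<phi> w p y < wp_norm \<Gamma> \<phi> w p x \<longleftrightarrow>
      \<Phi> K \<Gamma> \<phi> w p 1 (K f\<^sub>o) y < \<Phi> K \<Gamma> \<phi> w p 1 (K f\<^sub>o) x"
    if "x \<in> solution_set K f\<^sub>o" "y \<in> solution_set K f\<^sub>o" for x y
    using that p_pos by (simp add: ennpowr_less_iff objective_eq solution_set_def)
  then show ?thesis unfolding is_arg_min_def by blast
qed

lemma wp_norm_finite_iff: "wp_norm \<Gamma> \<phi> w p f < \<infinity> \<longleftrightarrow> penalty f < \<infinity>"
  unfolding wp_norm_def penalty_def by (auto simp: ennpowr_def less_top)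

text \<open>
  Both bounds come from comparing the objective at its minimizer with its value at \<open>f0\<close>, which is at most
  \<open>\<epsilon>\<^sup>2 + m * q\<close>.
\<close>

lemma objective_minimizer_bounds:
  assumes m: "0 < m" and q: "0 \<le> q" "penalty f0 \<le> ennreal q"
    and g: "norm (g - K f0) \<le> \<epsilon>"
    and min: "\<And>y. \<Phi> K \<Gamma> \<phi> w p m g f \<le> \<Phi> K \<Gamma> \<phi> w p m g y"
  shows "penalty f \<le> ennreal (q + \<epsilon>\<^sup>2 / m)"
    and "norm (K f - K f0) \<le> sqrt (\<epsilon>\<^sup>2 + m * q) + \<epsilon>"
proof -
  have sq: "(norm (K f0 - g))\<^sup>2 \<le> \<epsilon>\<^sup>2" using g by (simp add: norm_minus_commute power_mono)
  have nn: "0 \<le> \<epsilon>\<^sup>2 + m * q" using m q by simp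
  have "\<Phi> K \<Gamma> \<phi> w p m g f0 \<le> ennreal (\<epsilon>\<^sup>2 + m * q)"
    unfolding objective_le_iff[OF m nn]
  proof (intro allI impI, elim conjE)
    fix F assume "finite F" "F \<subseteq> \<Gamma>"
    then have "partial_penalty F f0 \<le> q" using q penalty_le_iff by blast
    then have "m * partial_penalty F f0 \<le> m * q" using m by simp
    then show "(norm (K f0 - g))\<^sup>2 + m * partial_penalty F f0 \<le> \<epsilon>\<^sup>2 + m * q" using sq by linarith
  qed
  then have "\<Phi> K \<Gamma> \<phi> w p m g f \<le> ennreal (\<epsilon>\<^sup>2 + m * q)" using min order_trans by blast
  then have le: "(norm (K f - g))\<^sup>2 + m * partial_penalty F f \<le> \<epsilon>\<^sup>2 + m * q"
    if "finite F" "F \<subseteq> \<Gamma>" for F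
    using that unfolding objective_le_iff[OF m nn] by blast
  have nn': "0 \<le> q + \<epsilon>\<^sup>2 / m" using q m by simp
  show "penalty f \<le> ennreal (q + \<epsilon>\<^sup>2 / m)"
    unfolding penalty_le_iff[OF nn']
  proof (intro allI impI, elim conjE)
    fix F assume "finite F" "F \<subseteq> \<Gamma>"
    then have "m * partial_penalty F f \<le> \<epsilon>\<^sup>2 + m * q"
      using le[of F] zero_le_power2[of "norm (K f - g)"] by linarith
    then show "partial_penalty F f \<le> q + \<epsilon>\<^sup>2 / m" using m by (simp add: field_simps)
  qed
  have "norm (K f - g) \<le> sqrt (\<epsilon>\<^sup>2 + m * q)" using le[of "{}"] by (intro real_le_rsqrt) simp
  then show "norm (K f - K f0) \<le> sqrt (\<epsilon>\<^sup>2 + m * q) + \<epsilon>"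
    using norm_triangle_ineq[of "K f - g" "g - K f0"] g by simp
qed

end

section \<open>Convergence of the regularized solutions\<close>

theorem theorem4p1:
  fixes K :: "'a::{real_inner, complete_space} \<Rightarrow> 'b::{real_inner, complete_space}"
    and \<Gamma> :: "'i set" and \<phi> :: "'i \<Rightarrow> 'a" and w :: "'i \<Rightarrow> real"
    and p c :: real and \<mu> :: "real \<Rightarrow> real" and f\<^sub>o :: 'a
  assumes basis: "orthonormal_basis_on \<Gamma> \<phi>"
    and K: "bounded_linear K" "onorm K < 1"
    and p: "1 \<le> p" "p \<le> 2"
    and w: "c > 0" "\<forall>\<gamma>\<in>\<Gamma>. c \<le> w \<gamma>"
    and p_or_inj: "p > 1 \<or> null_space K = {0}"
    and \<mu>_pos: "\<forall>\<epsilon>>0. \<mu> \<epsilon> > 0"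
    and \<mu>_lim: "(\<mu> \<longlongrightarrow> 0) (at_right 0)"
    and \<mu>_rate: "((\<lambda>\<epsilon>. \<epsilon>\<^sup>2 / \<mu> \<epsilon>) \<longlongrightarrow> 0) (at_right 0)"
    and finite_norm_solution: "\<exists>f\<in>solution_set K f\<^sub>o. wp_norm \<Gamma> \<phi> w p f < \<infinity>"
  shows "(\<forall>g. \<forall>m>0. \<exists>!f. is_arg_min (\<Phi> K \<Gamma> \<phi> w p m g) (\<lambda>f. f \<in> UNIV) f) \<and>
         (\<exists>!f. is_arg_min (wp_norm \<Gamma> \<phi> w p) (\<lambda>f. f \<in> solution_set K f\<^sub>o) f) \<and>
         ((\<lambda>\<epsilon>. SUP g\<in>{g. norm (g - K f\<^sub>o) \<le> \<epsilon>}.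
             ennreal (norm (f_star K \<Gamma> \<phi> w p (\<mu> \<epsilon>) g - f_dagger K \<Gamma> \<phi> w p f\<^sub>o)))
           \<longlongrightarrow> 0) (at_right 0)"
proof (intro conjI allI impI)
  interpret weighted_lp_penalty \<Gamma> \<phi> w p c
    using basis p w by unfold_locales auto
  let ?S = "solution_set K f\<^sub>o"
  have lin: "linear K" using K(1) by (rule bounded_linear.linear)
  have closed_S: "closed ?S" unfolding solution_set_def
    by (intro closed_Collect_eq continuous_intros bounded_linear.continuous_on[OF K(1)])
  have convex_S: "convex ?S"
  proof (rule convexI)
    fix x y and u v :: real assume "x \<in> ?S" "y \<in> ?S" "u + v = 1"
    then show "u *\<^sub>R x + v *\<^sub>R y \<in> ?S"
      by (simp add: solution_set_def linear_add[OF lin] linear_scale[OF lin] flip: scaleR_left_distrib)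
  qed
  show star: "\<exists>!f. is_arg_min (\<Phi> K \<Gamma> \<phi> w p m g) (\<lambda>f. f \<in> UNIV) f" if "0 < m" for m g
  proof (rule ex1_objective_minimizer[OF K(1) p_or_inj that])
    have "penalty 0 = 0" by (simp add: penalty_def)
    then show "\<Phi> K \<Gamma> \<phi> w p m g 0 < \<infinity>" by (simp add: objective_eq)
  qed auto
  obtain f1 where f1: "f1 \<in> ?S" "penalty f1 < \<infinity>"
    using finite_norm_solution wp_norm_finite_iff by blast
  show dagger: "\<exists>!f. is_arg_min (wp_norm \<Gamma> \<phi> w p) (\<lambda>f. f \<in> ?S) f"
    unfolding is_arg_min_wp_norm_iff
    by (rule ex1_objective_minimizer[OF K(1) p_or_inj _ closed_S convex_S f1(1)])
       (use f1 in \<open>auto simp: objective_eq ennreal_mult_less_top\<close>)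
  define fd where "fd = f_dagger K \<Gamma> \<phi> w p f\<^sub>o"
  have fd_min: "is_arg_min (wp_norm \<Gamma> \<phi> w p) (\<lambda>f. f \<in> ?S) fd"
    unfolding fd_def f_dagger_def arg_min_on_def arg_min_def using dagger by (metis someI_ex)
  then have K_fd: "K fd = K f\<^sub>o" unfolding is_arg_min_def solution_set_def by simp
  have fd_le: "penalty fd \<le> penalty h" if "h \<in> ?S" for h
    using fd_min[unfolded is_arg_min_wp_norm_iff] that K_fd unfolding is_arg_min_def
    by (auto simp: objective_eq solution_set_def not_less)
  have "penalty fd < \<infinity>" using fd_le[OF f1(1)] f1(2) by (rule le_less_trans)
  then obtain q where q: "0 \<le> q" "penalty fd = ennreal q" by (cases "penalty fd") auto
  have unique: "h = fd" if h: "K h = K fd" "penalty h \<le> ennreal q" for h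
  proof -
    have "is_arg_min (wp_norm \<Gamma> \<phi> w p) (\<lambda>f. f \<in> ?S) h"
      unfolding is_arg_min_wp_norm_iff using h fd_le K_fd q unfolding is_arg_min_def
      by (auto simp: objective_eq solution_set_def not_less intro: order_trans)
    then show ?thesis using fd_min dagger by blast
  qed
  have star_min: "\<Phi> K \<Gamma> \<phi> w p m g (f_star K \<Gamma> \<phi> w p m g) \<le> \<Phi> K \<Gamma> \<phi> w p m g y" if "0 < m" for m g y
  proof -
    have "is_arg_min (\<Phi> K \<Gamma> \<phi> w p m g) (\<lambda>f. f \<in> UNIV) (f_star K \<Gamma> \<phi> w p m g)"
      unfolding f_star_def arg_min_on_def arg_min_def using star[OF that] by (metis someI_ex)
    then show ?thesis by (simp add: is_arg_min_def not_less)
  qed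
  have pos: "\<forall>\<^sub>F \<epsilon>::real in at_right 0. 0 < \<epsilon>" by (rule eventually_at_right_less)
  \<comment> \<open>Any choice of admissible data, one for each noise level, gives convergence.\<close>
  have select: "((\<lambda>\<epsilon>. f_star K \<Gamma> \<phi> w p (\<mu> \<epsilon>) (g \<epsilon>)) \<longlongrightarrow> fd) (at_right 0)"
    if g: "\<And>\<epsilon>. 0 < \<epsilon> \<Longrightarrow> norm (g \<epsilon> - K f\<^sub>o) \<le> \<epsilon>" for g :: "real \<Rightarrow> 'b"
  proof -
    let ?f = "\<lambda>\<epsilon>. f_star K \<Gamma> \<phi> w p (\<mu> \<epsilon>) (g \<epsilon>)"
    have bounds: "penalty (?f \<epsilon>) \<le> ennreal (q + \<epsilon>\<^sup>2 / \<mu> \<epsilon>)"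
      "norm (K (?f \<epsilon>) - K fd) \<le> sqrt (\<epsilon>\<^sup>2 + \<mu> \<epsilon> * q) + \<epsilon>" if "0 < \<epsilon>" for \<epsilon>
      using objective_minimizer_bounds[of "\<mu> \<epsilon>" q fd "g \<epsilon>" K \<epsilon> "?f \<epsilon>"]
        that q g \<mu>_pos star_min by (simp_all add: K_fd)
    have near: "\<forall>\<^sub>F \<epsilon> in at_right 0. penalty (?f \<epsilon>) \<le> ennreal (q + \<tau>)" if "0 < \<tau>" for \<tau>
      using order_tendstoD(2)[OF \<mu>_rate that] pos
    proof eventually_elim
      case (elim \<epsilon>)
      then have "ennreal (q + \<epsilon>\<^sup>2 / \<mu> \<epsilon>) \<le> ennreal (q + \<tau>)" by (intro ennreal_leI) simp
      with bounds(1)[OF elim(2)] show ?case by (rule order_trans)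
    qed
    have "((\<lambda>\<epsilon>. sqrt (\<epsilon>\<^sup>2 + \<mu> \<epsilon> * q) + \<epsilon>) \<longlongrightarrow> sqrt (0\<^sup>2 + 0 * q) + 0) (at_right 0)"
      by (intro tendsto_intros \<mu>_lim)
    then have lim: "((\<lambda>\<epsilon>. sqrt (\<epsilon>\<^sup>2 + \<mu> \<epsilon> * q) + \<epsilon>) \<longlongrightarrow> 0) (at_right 0)" by simp
    have "((\<lambda>\<epsilon>. K (?f \<epsilon>) - K fd) \<longlongrightarrow> 0) (at_right 0)"
      by (rule Lim_null_comparison[OF eventually_mono[OF pos] lim]) (rule bounds(2))
    then have residual: "((\<lambda>\<epsilon>. K (?f \<epsilon>)) \<longlongrightarrow> K fd) (at_right 0)" by (simp add: LIM_zero_iff)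
    show ?thesis
      by (rule penalty_radon_riesz[OF q _ near])
         (rule weak_tendsto_of_near_minimal[OF K(1) q(1) unique residual near])
  qed
  let ?err = "\<lambda>\<epsilon> g. norm (f_star K \<Gamma> \<phi> w p (\<mu> \<epsilon>) g - fd)"
  have uniform: "\<forall>\<^sub>F \<epsilon> in at_right 0. \<forall>g. norm (g - K f\<^sub>o) \<le> \<epsilon> \<longrightarrow> ?err \<epsilon> g \<le> \<delta>" if \<delta>: "0 < \<delta>" for \<delta>
  proof -
    \<comment> \<open>Uniformity: at each noise level take data that violate the bound, if there are any.\<close>
    define bad where "bad \<epsilon> g \<longleftrightarrow> norm (g - K f\<^sub>o) \<le> \<epsilon> \<and> \<delta> < ?err \<epsilon> g" for \<epsilon> g
    define g where "g \<epsilon> = (if \<exists>g. bad \<epsilon> g then SOME g. bad \<epsilon> g else K f\<^sub>o)" for \<epsilon>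
    have g_bad: "bad \<epsilon> (g \<epsilon>)" if "bad \<epsilon> h" for \<epsilon> h
      using that unfolding g_def by (metis someI_ex)
    have g_near: "norm (g \<epsilon> - K f\<^sub>o) \<le> \<epsilon>" if "0 < \<epsilon>" for \<epsilon>
    proof (cases "\<exists>h. bad \<epsilon> h")
      case True
      then show ?thesis using g_bad bad_def by blast
    next
      case False
      then show ?thesis using that by (simp add: g_def)
    qed
    have "\<forall>\<^sub>F \<epsilon> in at_right 0. dist (f_star K \<Gamma> \<phi> w p (\<mu> \<epsilon>) (g \<epsilon>)) fd < \<delta>"
      by (rule tendstoD[OF select \<delta>]) (rule g_near)
    then show ?thesis
    proof eventually_elim
      case (elim \<epsilon>)
      then have "\<not> bad \<epsilon> (g \<epsilon>)" by (simp add: bad_def dist_norm)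
      then show ?case using g_bad unfolding bad_def by (meson not_le)
    qed
  qed
  show "((\<lambda>\<epsilon>. SUP g\<in>{g. norm (g - K f\<^sub>o) \<le> \<epsilon>}.
             ennreal (norm (f_star K \<Gamma> \<phi> w p (\<mu> \<epsilon>) g - f_dagger K \<Gamma> \<phi> w p f\<^sub>o)))
           \<longlongrightarrow> 0) (at_right 0)"
    unfolding fd_def[symmetric]
  proof (rule order_tendstoI)
    fix a :: ennreal assume "0 < a"
    then obtain b where b: "0 < b" "b < a" using dense by blast
    then have "b < \<infinity>" by (metis infinity_ennreal_def less_le_trans top_greatest)
    then obtain \<delta> where \<delta>: "0 < \<delta>" "b = ennreal \<delta>" using b by (cases b) auto
    show "\<forall>\<^sub>F \<epsilon> in at_right 0. (SUP g\<in>{g. norm (g - K f\<^sub>o) \<le> \<epsilon>}. ennreal (?err \<epsilon> g)) < a"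
      using uniform[OF \<delta>(1)]
    proof eventually_elim
      case (elim \<epsilon>)
      then have "(SUP g\<in>{g. norm (g - K f\<^sub>o) \<le> \<epsilon>}. ennreal (?err \<epsilon> g)) \<le> ennreal \<delta>"
        by (intro SUP_least) (simp add: ennreal_leI)
      then show ?case using b \<delta> by simp
    qed
  qed simp
qed

end
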